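(* Let $G=(V,E)$ be a finite connected graph with girth at least $6$, with edges $E=\{e_1,\dots,e_n\}$, let $\kappa^*=(\kappa_1^*,\dots,\kappa_n^* )\in\mathbb{R}^n$ be a prescribed curvature, and let $\bm\omega_0\in\mathbb{R}^n_{>0}$ be a positive initial value. Let $\bm\omega(t)$, $t\ge 0$, be the solution of the Ricci flow $$\frac{d}{dt}\omega_i(t)=-(\kappa_i(\bm\omega(t))-\kappa_i^* )\,\omega_i(t),\quad i=1,\dots,n,\qquad \bm\omega(0)=\bm\omega_0 .$$ Then $\bm\omega(t)$ converges exponentially as $t\to\infty$ to a weight of the prescribed curvature $\kappa^*$ (i.e. there are $\bm\omega_\infty\in\mathbb{R}^n_{>0}$ with $\kappa_i(\bm\omega_\infty)=\kappa_i^*$ for all $i$ and constants $C,\lambda>0$ with $\|\bm\omega(t)-\bm\omega_\infty\|\le Ce^{-\lambda t}$ for all $t\ge0$) if and only if $\kappa^*$ is attainable.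
   Context: Graphs are finite, connected, undirected and simple. The girth is the length of a shortest cycle; girth at least $6$ means there are no cycles of length $3$, $4$ or $5$ (trees are included). A weight is a vector $\bm\omega=(\omega_1,\dots,\omega_n)\in\mathbb{R}^n_{>0}$ with $\omega_i=\omega(e_i)$; $\omega_{xy}=\omega_{yx}$ is the weight of edge $(x,y)$. Write $y\sim x$ if $(x,y)\in E$, and $m(x)=\sum_{y\sim x}\omega_{xy}$. The distance $d(u,v)$ is the combinatorial one (number of edges of a shortest path) and does not depend on the weights or on time. Lin-Lu-Yau curvature: for $x\in V$ and $\alpha\in(0,1)$ let $m_x^\alpha$ be the probability measure with $m_x^\alpha(x)=\alpha$, $m_x^\alpha(y)=(1-\alpha)\omega_{xy}/m(x)$ for $y\sim x$, and $0$ otherwise. For $x\ne y$, $\kappa(x,y)=\lim_{\alpha\to1^-}\frac{1}{1-\alpha}\left(1-\frac{W(m_x^\alpha,m_y^\alpha)}{d(x,y)}\right)$, where $W$ is the $1$-Wasserstein distance with respect to $d$. For an edge $e_i=(x,y)$ put $\kappa_i(\bm\omega)=\kappa(x,y)$. On a graph with girth at least $6$ one has, for every edge $e=(x,y)$, $\kappa_e=2\omega_e\left(\frac1{m(x)}+\frac1{m(y)}\right)-2$. The prescribed curvature $\kappa^*$ is attainable if there exists $\bm\omega^*\in\mathbb{R}^n_{>0}$ with $\kappa_i(\bm\omega^* )=\kappa_i^*$ for all $i$; such $\bm\omega^*$ is called a weight of $\kappa^*$. *)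

theory Defs
  imports "HOL-Analysis.Analysis"
begin

section \<open>Graphs, distance, girth\<close>

text \<open>A graph is given by its vertex set \<open>V\<close> and its set \<open>E\<close> of two-element vertex sets.\<close>

definition simple_graph :: "'v set \<Rightarrow> 'v set set \<Rightarrow> bool" where
  "simple_graph V E \<longleftrightarrow> finite V \<and> (\<forall>e\<in>E. e \<subseteq> V \<and> card e = 2)"

definition walk :: "'v set set \<Rightarrow> 'v list \<Rightarrow> bool" where
  "walk E p \<longleftrightarrow> p \<noteq> [] \<and> successively (\<lambda>x y. {x, y} \<in> E) p"

definition connected_graph :: "'v set \<Rightarrow> 'v set set \<Rightarrow> bool" where
  "connected_graph V E \<longleftrightarrow>
     V \<noteq> {} \<and> (\<forall>x\<in>V. \<forall>y\<in>V. \<exists>p. walk E p \<and> hd p = x \<and> last p = y)"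

text \<open>A vertex list of length \<open>k + 1\<close> is a walk with \<open>k\<close> edges.\<close>

definition gdist :: "'v set set \<Rightarrow> 'v \<Rightarrow> 'v \<Rightarrow> nat" where
  "gdist E x y = (LEAST k. \<exists>p. walk E p \<and> hd p = x \<and> last p = y \<and> length p = k + 1)"

text \<open>The closing edge from \<open>last p\<close> to \<open>hd p\<close> is not repeated in the list, so a cycle \<open>p\<close> has
  \<open>length p\<close> edges.\<close>

definition cycle :: "'v set set \<Rightarrow> 'v list \<Rightarrow> bool" where
  "cycle E p \<longleftrightarrow> length p \<ge> 3 \<and> distinct p \<and> walk E p \<and> {last p, hd p} \<in> E"

text \<open>The girth of a forest is \<open>\<infinity>\<close>.\<close>

definition girth :: "'v set set \<Rightarrow> enat" where
  "girth E = (INF p\<in>{p. cycle E p}. enat (length p))"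

section \<open>Lin-Lu-Yau curvature\<close>

text \<open>A weight is a function on edges; only its values on \<open>E\<close> matter.\<close>

definition positive_weight :: "'v set set \<Rightarrow> ('v set \<Rightarrow> real) \<Rightarrow> bool" where
  "positive_weight E \<omega> \<longleftrightarrow> (\<forall>e\<in>E. \<omega> e > 0)"

definition wdeg :: "'v set set \<Rightarrow> ('v set \<Rightarrow> real) \<Rightarrow> 'v \<Rightarrow> real" where
  "wdeg E \<omega> x = (\<Sum>y | {x, y} \<in> E. \<omega> {x, y})"

definition lazy_measure ::
  "'v set set \<Rightarrow> ('v set \<Rightarrow> real) \<Rightarrow> real \<Rightarrow> 'v \<Rightarrow> 'v \<Rightarrow> real" where
  "lazy_measure E \<omega> \<alpha> x z =
     (if z = x then \<alpha>
      else if {x, z} \<in> E then (1 - \<alpha>) * \<omega> {x, z} / wdeg E \<omega> x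
      else 0)"

definition coupling ::
  "'v set \<Rightarrow> ('v \<Rightarrow> real) \<Rightarrow> ('v \<Rightarrow> real) \<Rightarrow> ('v \<Rightarrow> 'v \<Rightarrow> real) \<Rightarrow> bool" where
  "coupling V \<mu> \<nu> \<pi> \<longleftrightarrow>
     (\<forall>u\<in>V. \<forall>v\<in>V. \<pi> u v \<ge> 0) \<and>
     (\<forall>u\<in>V. (\<Sum>v\<in>V. \<pi> u v) = \<mu> u) \<and>
     (\<forall>v\<in>V. (\<Sum>u\<in>V. \<pi> u v) = \<nu> v)"

definition wasserstein ::
  "'v set \<Rightarrow> 'v set set \<Rightarrow> ('v \<Rightarrow> real) \<Rightarrow> ('v \<Rightarrow> real) \<Rightarrow> real" where
  "wasserstein V E \<mu> \<nu> =
     (INF \<pi>\<in>{\<pi>. coupling V \<mu> \<nu> \<pi>}. \<Sum>u\<in>V. \<Sum>v\<in>V. \<pi> u v * real (gdist E u v))"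

definition lly_curvature ::
  "'v set \<Rightarrow> 'v set set \<Rightarrow> ('v set \<Rightarrow> real) \<Rightarrow> 'v \<Rightarrow> 'v \<Rightarrow> real" where
  "lly_curvature V E \<omega> x y =
     Lim (at_left 1) (\<lambda>\<alpha>. 1 / (1 - \<alpha>) *
       (1 - wasserstein V E (lazy_measure E \<omega> \<alpha> x) (lazy_measure E \<omega> \<alpha> y) / real (gdist E x y)))"

text \<open>The description is independent of the orientation of the edge because the curvature is
  symmetric in its two endpoints; see \<open>edge_curvature_eq\<close> below.\<close>

definition edge_curvature ::
  "'v set \<Rightarrow> 'v set set \<Rightarrow> ('v set \<Rightarrow> real) \<Rightarrow> 'v set \<Rightarrow> real" where
  "edge_curvature V E \<omega> e = (THE k. \<exists>x y. e = {x, y} \<and> k = lly_curvature V E \<omega> x y)"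

lemma gdist_commute: "gdist E x y = gdist E y x"
proof -
  have *: "\<exists>p. walk E p \<and> hd p = y \<and> last p = x \<and> length p = k + 1"
    if "\<exists>p. walk E p \<and> hd p = x \<and> last p = y \<and> length p = k + 1" for x y k
  proof -
    from that obtain p where "walk E p" "hd p = x" "last p = y" "length p = k + 1" by blast
    then have "walk E (rev p) \<and> hd (rev p) = y \<and> last (rev p) = x \<and> length (rev p) = k + 1"
      by (auto simp: walk_def hd_rev last_rev insert_commute)
    then show ?thesis by blast
  qed
  show ?thesis unfolding gdist_def
    by (rule arg_cong[where f = Least], rule ext, rule iffI) (erule *)+
qed

lemma wasserstein_commute: "wasserstein V E \<mu> \<nu> = wasserstein V E \<nu> \<mu>"
proof -
  let ?c = "\<lambda>\<pi>. \<Sum>u\<in>V. \<Sum>v\<in>V. \<pi> u v * real (gdist E u v)"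
  have *: "?c ` {\<pi>. coupling V \<mu> \<nu> \<pi>} \<subseteq> ?c ` {\<pi>. coupling V \<nu> \<mu> \<pi>}" for \<mu> \<nu>
  proof (rule image_subsetI)
    fix \<pi> assume "\<pi> \<in> {\<pi>. coupling V \<mu> \<nu> \<pi>}"
    then have "coupling V \<nu> \<mu> (\<lambda>u v. \<pi> v u)" by (auto simp: coupling_def)
    moreover have "?c \<pi> = ?c (\<lambda>u v. \<pi> v u)"
      by (rule trans[OF sum.swap]) (intro sum.cong refl arg_cong2[where f = times] arg_cong[where f = real] gdist_commute)
    ultimately show "?c \<pi> \<in> ?c ` {\<pi>. coupling V \<nu> \<mu> \<pi>}"
      by (intro image_eqI[where x = "\<lambda>u v. \<pi> v u"]) simp_all
  qed
  show ?thesis unfolding wasserstein_def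
    by (rule arg_cong[where f = Inf], rule equalityI) (rule *)+
qed

lemma lly_curvature_commute: "lly_curvature V E \<omega> x y = lly_curvature V E \<omega> y x"
  unfolding lly_curvature_def gdist_commute[of E x y]
  by (subst wasserstein_commute) (rule refl)

lemma edge_curvature_eq: "edge_curvature V E \<omega> {x, y} = lly_curvature V E \<omega> x y"
  unfolding edge_curvature_def
  by (rule the_equality) (use lly_curvature_commute[of V E \<omega> x y] in \<open>auto simp: doubleton_eq_iff\<close>)

section \<open>Prescribed curvature and the Ricci flow\<close>

definition weight_of_curvature ::
  "'v set \<Rightarrow> 'v set set \<Rightarrow> ('v set \<Rightarrow> real) \<Rightarrow> ('v set \<Rightarrow> real) \<Rightarrow> bool" where
  "weight_of_curvature V E \<kappa> \<omega> \<longleftrightarrow>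
     positive_weight E \<omega> \<and> (\<forall>e\<in>E. edge_curvature V E \<omega> e = \<kappa> e)"

definition attainable :: "'v set \<Rightarrow> 'v set set \<Rightarrow> ('v set \<Rightarrow> real) \<Rightarrow> bool" where
  "attainable V E \<kappa> \<longleftrightarrow> (\<exists>\<omega>. weight_of_curvature V E \<kappa> \<omega>)"

text \<open>The curvature is only defined for positive weights, so a solution lives in the positive
  orthant. The derivative at \<open>t = 0\<close> is one-sided.\<close>

definition ricci_flow_solution ::
  "'v set \<Rightarrow> 'v set set \<Rightarrow> ('v set \<Rightarrow> real) \<Rightarrow> ('v set \<Rightarrow> real) \<Rightarrow> (real \<Rightarrow> 'v set \<Rightarrow> real) \<Rightarrow> bool" where
  "ricci_flow_solution V E \<kappa> \<omega>\<^sub>0 \<omega> \<longleftrightarrow>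
     (\<forall>e\<in>E. \<omega> 0 e = \<omega>\<^sub>0 e) \<and>
     (\<forall>t\<ge>0. positive_weight E (\<omega> t) \<and>
       (\<forall>e\<in>E. ((\<lambda>s. \<omega> s e) has_real_derivative
                 - (edge_curvature V E (\<omega> t) e - \<kappa> e) * \<omega> t e) (at t within {0..})))"

definition converges_exponentially ::
  "'v set set \<Rightarrow> (real \<Rightarrow> 'v set \<Rightarrow> real) \<Rightarrow> ('v set \<Rightarrow> real) \<Rightarrow> bool" where
  "converges_exponentially E \<omega> \<eta> \<longleftrightarrow>
     (\<exists>C>0. \<exists>r>0. \<forall>t\<ge>0. L2_set (\<lambda>e. \<omega> t e - \<eta> e) E \<le> C * exp (- r * t))"

end

theory Submission
  imports Defs
begin

text \<open>
  Two ideas carry the proof: an explicit formula for the curvature, and the fact that the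
  flow conserves the mean and dissipates the square sum of the logarithmic ratios of \<open>\<omega>\<close> to a
  weight of the prescribed curvature.

  \<^bold>\<open>The curvature.\<close> Let \<open>{x, y}\<close> be an edge and let \<open>f\<close> be \<open>3\<close> on the neighbours of \<open>x\<close> other
  than \<open>y\<close>, \<open>2\<close> at \<open>x\<close>, \<open>1\<close> at \<open>y\<close> and \<open>0\<close> on the neighbours of \<open>y\<close> other than \<open>x\<close>. Without
  cycles of length \<open>3\<close>, \<open>4\<close> and \<open>5\<close>, the distance from a vertex charged by the lazy measure at
  \<open>x\<close> to a vertex charged by the one at \<open>y\<close> is exactly the drop of \<open>f\<close>, except for the pair
  \<open>(y, x)\<close>. Hence every coupling that moves no mass from \<open>y\<close> to \<open>x\<close> is optimal, and \<open>f\<close> certifies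
  it. For idleness \<open>\<alpha>\<close> near \<open>1\<close> its cost is \<open>1 - (1 - \<alpha>) * k\<close> with \<open>k\<close> independent of \<open>\<alpha>\<close>, so the
  limit in the definition of the curvature is that of a function which is eventually constant
  (\<open>lly_curvature_edge\<close>). With \<open>m(x)\<close> the weighted degree this reads
  \<open>\<kappa>(e) = 2 * (\<Sum>x\<in>e. \<omega>(e) / m(x)) - 2\<close> (\<open>edge_curvature_formula\<close>).

  \<^bold>\<open>The flow.\<close> Let \<open>\<eta>\<close> be a weight of the prescribed curvature and put
  \<open>s(e) = ln (\<omega>(e) / \<eta>(e))\<close>. By the formula, the flow becomes
  \<open>s'(e) = 2 * (\<Sum>x\<in>e. \<eta>(e) / m\<^sub>\<eta>(x) - \<omega>(e) / m\<^sub>\<omega>(x))\<close>. At every vertex that has an edge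
  both kinds of quotients sum to \<open>1\<close>, so the sum of all \<open>s(e)\<close> is conserved; since the
  curvature does not change when \<open>\<eta>\<close> is multiplied by a positive constant, that sum may be assumed
  to vanish. The contribution of a vertex to the derivative of \<open>L = (\<Sum>e. s(e)\<^sup>2)\<close> is, up to a
  positive factor, minus a covariance of \<open>s\<close> and \<open>exp s\<close>, and the covariance is nonnegative because \<open>exp\<close> increases (\<open>sum_covariance_pairs\<close>, \<open>dissipation_at_vertex\<close>). Thus
  \<open>L\<close> decreases and \<open>s\<close> stays bounded; on a bounded set the dissipation dominates a multiple of
  the sum of the squared differences of \<open>s\<close> over pairs of edges with a common vertex. As the graph is
  connected and \<open>s\<close> has mean zero, this sum dominates a multiple of \<open>L\<close> (\<open>edge_poincare\<close>), so
  \<open>L\<close>, and with it \<open>\<omega> - \<eta>\<close>, decays exponentially (\<open>log_ratio_decay\<close>).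
\<close>

section \<open>Distances in graphs of girth at least six\<close>

text \<open>Naming the predicate under the \<open>LEAST\<close> of \<open>gdist\<close> lets it be evaluated by recursion on the
  number of steps.\<close>

definition linked :: "'v set set \<Rightarrow> nat \<Rightarrow> 'v \<Rightarrow> 'v \<Rightarrow> bool" where
  "linked E k x y \<longleftrightarrow> (\<exists>p. walk E p \<and> hd p = x \<and> last p = y \<and> length p = k + 1)"

lemma linked_0 [simp]: "linked E 0 x y \<longleftrightarrow> x = y"
proof
  assume "linked E 0 x y"
  then show "x = y" unfolding linked_def by (auto simp: length_Suc_conv)
next
  assume "x = y"
  then show "linked E 0 x y" unfolding linked_def walk_def by (intro exI[of _ "[x]"]) auto
qed

lemma linked_Suc [simp]: "linked E (Suc k) x y \<longleftrightarrow> (\<exists>c. {x, c} \<in> E \<and> linked E k c y)"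
proof
  assume "linked E (Suc k) x y"
  then obtain p where p: "walk E p" "hd p = x" "last p = y" "length p = Suc (Suc k)"
    unfolding linked_def by auto
  then obtain c q where "p = x # c # q" by (cases p; cases "tl p") auto
  with p have "{x, c} \<in> E" "linked E k c y"
    unfolding linked_def walk_def by (auto intro!: exI[of _ "c # q"])
  then show "\<exists>c. {x, c} \<in> E \<and> linked E k c y" by blast
next
  assume "\<exists>c. {x, c} \<in> E \<and> linked E k c y"
  then obtain c p where "{x, c} \<in> E" "walk E p" "hd p = c" "last p = y" "length p = k + 1"
    unfolding linked_def by auto
  then show "linked E (Suc k) x y"
    unfolding linked_def walk_def
    by (intro exI[of _ "x # p"]) (auto simp: successively_Cons)
qed

lemma gdist_eqI:
  assumes "linked E k x y" "\<And>j. j < k \<Longrightarrow> \<not> linked E j x y"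
  shows "gdist E x y = k"
  unfolding gdist_def linked_def[symmetric]
  using assms by (intro Least_equality) (auto simp: not_less[symmetric])

lemma gdist_self: "gdist E x x = 0"
  by (rule gdist_eqI) auto

lemma simple_graph_edgeD:
  assumes "simple_graph V E" "{x, y} \<in> E"
  shows "x \<in> V" "y \<in> V" "x \<noteq> y"
  using assms by (auto simp: simple_graph_def)

lemma simple_graph_no_loop: "simple_graph V E \<Longrightarrow> {x} \<notin> E"
  by (auto simp: simple_graph_def)

lemma gdist_adjacent:
  assumes "simple_graph V E" "{x, y} \<in> E"
  shows "gdist E x y = 1"
  using assms simple_graph_edgeD[OF assms]
  by (intro gdist_eqI) auto

lemma cycle_length_ge_girth: "cycle E p \<Longrightarrow> girth E \<le> enat (length p)"
  unfolding girth_def by (rule INF_lower) simp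

lemma no_short_cycles:
  assumes "simple_graph V E" "girth E \<ge> 6"
  shows no_triangle: "{a, b} \<in> E \<Longrightarrow> {b, c} \<in> E \<Longrightarrow> {c, a} \<notin> E"
    and no_square: "{a, b} \<in> E \<Longrightarrow> {b, c} \<in> E \<Longrightarrow> {c, d} \<in> E \<Longrightarrow> a \<noteq> c \<Longrightarrow> b \<noteq> d \<Longrightarrow> {d, a} \<notin> E"
    and no_pentagon: "{a, b} \<in> E \<Longrightarrow> {b, c} \<in> E \<Longrightarrow> {c, d} \<in> E \<Longrightarrow> {d, e} \<in> E \<Longrightarrow>
      distinct [a, b, c, d, e] \<Longrightarrow> {e, a} \<notin> E"
proof -
  have ge: "length p \<ge> 6" if "cycle E p" for p
  proof -
    have "(6::enat) \<le> enat (length p)"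
      using assms(2) cycle_length_ge_girth[OF that] by (rule order.trans)
    then show ?thesis by (simp add: numeral_eq_enat)
  qed
  note ne = simple_graph_edgeD(3)[OF assms(1)]
  show "{c, a} \<notin> E" if "{a, b} \<in> E" "{b, c} \<in> E"
  proof
    assume "{c, a} \<in> E"
    with that have "cycle E [a, b, c]"
      using ne[of a b] ne[of b c] ne[of c a] by (auto simp: cycle_def walk_def)
    from ge[OF this] show False by simp
  qed
  show "{d, a} \<notin> E" if "{a, b} \<in> E" "{b, c} \<in> E" "{c, d} \<in> E" "a \<noteq> c" "b \<noteq> d"
  proof
    assume "{d, a} \<in> E"
    with that have "cycle E [a, b, c, d]"
      using ne[of a b] ne[of b c] ne[of c d] ne[of d a] by (auto simp: cycle_def walk_def)
    from ge[OF this] show False by simp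
  qed
  show "{e, a} \<notin> E" if "{a, b} \<in> E" "{b, c} \<in> E" "{c, d} \<in> E" "{d, e} \<in> E"
    "distinct [a, b, c, d, e]"
  proof
    assume "{e, a} \<in> E"
    with that have "cycle E [a, b, c, d, e]" by (auto simp: cycle_def walk_def)
    from ge[OF this] show False by simp
  qed
qed

section \<open>The curvature of an edge\<close>

lemma coupling_support:
  assumes "finite V" "coupling V \<mu> \<nu> \<pi>" "u \<in> V" "v \<in> V" "\<pi> u v \<noteq> 0"
  shows "\<mu> u \<noteq> 0" "\<nu> v \<noteq> 0"
proof -
  have pos: "\<pi> u v > 0" using assms by (auto simp: coupling_def less_le)
  have "\<pi> u v \<le> (\<Sum>v\<in>V. \<pi> u v)"
    using assms by (intro member_le_sum) (auto simp: coupling_def)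
  moreover have "\<pi> u v \<le> (\<Sum>u\<in>V. \<pi> u v)"
    using assms by (intro member_le_sum[where f = "\<lambda>u. \<pi> u v"]) (auto simp: coupling_def)
  ultimately show "\<mu> u \<noteq> 0" "\<nu> v \<noteq> 0" using assms pos by (auto simp: coupling_def)
qed

text \<open>Integrating \<open>f u - f v\<close> sees only the marginals of a coupling. A potential that is bounded by
  the distance therefore bounds every transport cost from below by a quantity that does not depend
  on the coupling.\<close>

lemma coupling_cost_of_potential:
  assumes "coupling V \<mu> \<nu> \<pi>"
  shows "(\<Sum>u\<in>V. \<Sum>v\<in>V. \<pi> u v * (f u - f v)) = (\<Sum>u\<in>V. \<mu> u * f u) - (\<Sum>v\<in>V. \<nu> v * f v)"
proof -
  have "(\<Sum>u\<in>V. \<Sum>v\<in>V. \<pi> u v * (f u - f v)) =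
    (\<Sum>u\<in>V. \<Sum>v\<in>V. \<pi> u v * f u) - (\<Sum>u\<in>V. \<Sum>v\<in>V. \<pi> u v * f v)"
    by (simp add: algebra_simps sum_subtractf)
  also have "(\<Sum>u\<in>V. \<Sum>v\<in>V. \<pi> u v * f u) = (\<Sum>u\<in>V. \<mu> u * f u)"
    using assms by (intro sum.cong refl) (simp add: coupling_def flip: sum_distrib_right)
  also have "(\<Sum>u\<in>V. \<Sum>v\<in>V. \<pi> u v * f v) = (\<Sum>v\<in>V. \<nu> v * f v)"
    using assms by (subst sum.swap, intro sum.cong refl)
      (simp add: coupling_def flip: sum_distrib_right)
  finally show ?thesis .
qed

text \<open>Complementary slackness: the potential bounds the cost of every coupling, and the coupling that
  uses only tight pairs attains the bound. The Lipschitz condition is asked only for charged pairs,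
  which are the only ones a coupling can use; so the potential needs no extension to a Lipschitz
  function on the whole graph.\<close>

lemma wasserstein_eq_potential:
  fixes f :: "'v \<Rightarrow> real"
  assumes "finite V" "coupling V \<mu> \<nu> \<pi>"
    and lipschitz: "\<And>u v. u \<in> V \<Longrightarrow> v \<in> V \<Longrightarrow> \<mu> u \<noteq> 0 \<Longrightarrow> \<nu> v \<noteq> 0 \<Longrightarrow> f u - f v \<le> real (gdist E u v)"
    and tight: "\<And>u v. u \<in> V \<Longrightarrow> v \<in> V \<Longrightarrow> \<pi> u v \<noteq> 0 \<Longrightarrow> real (gdist E u v) = f u - f v"
  shows "wasserstein V E \<mu> \<nu> = (\<Sum>u\<in>V. \<mu> u * f u) - (\<Sum>v\<in>V. \<nu> v * f v)"
  unfolding wasserstein_def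
proof (rule cInf_eq_minimum)
  have "(\<Sum>u\<in>V. \<Sum>v\<in>V. \<pi> u v * real (gdist E u v)) = (\<Sum>u\<in>V. \<Sum>v\<in>V. \<pi> u v * (f u - f v))"
    using tight by (intro sum.cong refl) auto
  with assms(2) show "(\<Sum>u\<in>V. \<mu> u * f u) - (\<Sum>v\<in>V. \<nu> v * f v)
      \<in> (\<lambda>\<pi>. \<Sum>u\<in>V. \<Sum>v\<in>V. \<pi> u v * real (gdist E u v)) ` {\<pi>. coupling V \<mu> \<nu> \<pi>}"
    by (intro image_eqI[where x = \<pi>]) (auto simp: coupling_cost_of_potential)
next
  fix c assume "c \<in> (\<lambda>\<pi>. \<Sum>u\<in>V. \<Sum>v\<in>V. \<pi> u v * real (gdist E u v)) ` {\<pi>. coupling V \<mu> \<nu> \<pi>}"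
  then obtain \<rho> where \<rho>: "coupling V \<mu> \<nu> \<rho>"
    and c: "c = (\<Sum>u\<in>V. \<Sum>v\<in>V. \<rho> u v * real (gdist E u v))" by auto
  have "\<rho> u v * (f u - f v) \<le> \<rho> u v * real (gdist E u v)" if "u \<in> V" "v \<in> V" for u v
  proof (cases "\<rho> u v = 0")
    case False
    then show ?thesis
      using that \<rho> coupling_support[OF assms(1) \<rho> that False] lipschitz[OF that]
      by (intro mult_left_mono) (auto simp: coupling_def)
  qed simp
  then have "(\<Sum>u\<in>V. \<Sum>v\<in>V. \<rho> u v * (f u - f v)) \<le> c"
    unfolding c by (intro sum_mono)
  then show "(\<Sum>u\<in>V. \<mu> u * f u) - (\<Sum>v\<in>V. \<nu> v * f v) \<le> c"
    using \<rho> by (simp add: coupling_cost_of_potential)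
qed

text \<open>All the mass that the first measure has at \<open>y\<close> stays there, and the remaining parts of the two
  measures are coupled independently. In particular no mass leaves \<open>y\<close>.\<close>

lemma coupling_fixing_vertex:
  assumes "finite V" "y \<in> V" "\<And>u. u \<in> V \<Longrightarrow> \<mu> u \<ge> 0" "\<And>u. u \<in> V \<Longrightarrow> \<nu> u \<ge> 0"
    and "sum \<mu> V = 1" "sum \<nu> V = 1" "\<mu> y \<le> \<nu> y" "\<mu> y < 1"
  shows "coupling V \<mu> \<nu> (\<lambda>u v. if u = y then if v = y then \<mu> y else 0
           else \<mu> u * (\<nu> v - (if v = y then \<mu> y else 0)) / (1 - \<mu> y))"
  (is "coupling V \<mu> \<nu> ?\<pi>")
proof -
  let ?r = "\<lambda>v. \<nu> v - (if v = y then \<mu> y else 0)"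
  have nonneg: "?\<pi> u v \<ge> 0" if "u \<in> V" "v \<in> V" for u v
    using assms that by (auto intro!: mult_nonneg_nonneg divide_nonneg_nonneg)
  have row: "(\<Sum>v\<in>V. ?\<pi> u v) = \<mu> u" if "u \<in> V" for u
  proof (cases "u = y")
    case True
    then show ?thesis using assms by (simp add: sum.delta)
  next
    case False
    have "(\<Sum>v\<in>V. ?\<pi> u v) = \<mu> u * (\<Sum>v\<in>V. ?r v) / (1 - \<mu> y)"
      using False by (simp add: sum_distrib_left sum_divide_distrib)
    also have "(\<Sum>v\<in>V. ?r v) = 1 - \<mu> y"
      using assms by (simp add: sum_subtractf sum.delta)
    finally show ?thesis using assms by simp
  qed
  have col: "(\<Sum>u\<in>V. ?\<pi> u v) = \<nu> v" if "v \<in> V" for v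
  proof -
    have "(\<Sum>u\<in>V. ?\<pi> u v) = ?\<pi> y v + (\<Sum>u\<in>V - {y}. ?\<pi> u v)"
      using assms by (simp add: sum.remove)
    also have "(\<Sum>u\<in>V - {y}. ?\<pi> u v) = (\<Sum>u\<in>V - {y}. \<mu> u * (?r v / (1 - \<mu> y)))"
      by (intro sum.cong) auto
    also have "\<dots> = (\<Sum>u\<in>V - {y}. \<mu> u) * (?r v / (1 - \<mu> y))"
      by (simp only: sum_distrib_right)
    also have "(\<Sum>u\<in>V - {y}. \<mu> u) = 1 - \<mu> y"
      using assms by (simp add: sum_diff1)
    finally show ?thesis using assms by auto
  qed
  show ?thesis unfolding coupling_def using nonneg row col by blast
qed

lemma finite_neighbours:
  assumes "simple_graph V E"
  shows "finite {y. {x, y} \<in> E}"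
  using assms by (intro finite_subset[of "{y. {x, y} \<in> E}" V]) (auto simp: simple_graph_def)

lemma wdeg_pos:
  assumes "simple_graph V E" "positive_weight E \<omega>" "{x, y} \<in> E"
  shows "wdeg E \<omega> x > 0"
  unfolding wdeg_def using assms finite_neighbours[OF assms(1)]
  by (intro sum_pos) (auto simp: positive_weight_def)

lemma sum_lazy_measure:
  assumes "simple_graph V E" "x \<in> V"
  shows "(\<Sum>u\<in>V. lazy_measure E \<omega> \<alpha> x u * h u) =
    \<alpha> * h x + (1 - \<alpha>) * (\<Sum>y | {x, y} \<in> E. \<omega> {x, y} * h y) / wdeg E \<omega> x"
proof -
  have fin: "finite V" using assms by (simp add: simple_graph_def)
  have "(\<Sum>u\<in>V. lazy_measure E \<omega> \<alpha> x u * h u) =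
     \<alpha> * h x + (\<Sum>u\<in>V - {x}. lazy_measure E \<omega> \<alpha> x u * h u)"
    using fin assms by (subst sum.remove[of V x]) (auto simp: lazy_measure_def)
  also have "(\<Sum>u\<in>V - {x}. lazy_measure E \<omega> \<alpha> x u * h u) =
     (\<Sum>u | {x, u} \<in> E. lazy_measure E \<omega> \<alpha> x u * h u)"
    using fin simple_graph_edgeD[OF assms(1)] simple_graph_no_loop[OF assms(1)]
    by (intro sum.mono_neutral_right) (auto simp: lazy_measure_def)
  also have "\<dots> = (\<Sum>u | {x, u} \<in> E. (1 - \<alpha>) * (\<omega> {x, u} * h u) / wdeg E \<omega> x)"
    using simple_graph_no_loop[OF assms(1)]
    by (intro sum.cong) (auto simp: lazy_measure_def)
  also have "\<dots> = (1 - \<alpha>) * (\<Sum>u | {x, u} \<in> E. \<omega> {x, u} * h u) / wdeg E \<omega> x"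
    by (simp add: sum_distrib_left sum_divide_distrib)
  finally show ?thesis .
qed

lemma lazy_measure_nonneg:
  assumes "simple_graph V E" "positive_weight E \<omega>" "0 \<le> \<alpha>" "\<alpha> \<le> 1"
  shows "lazy_measure E \<omega> \<alpha> x u \<ge> 0"
  using assms wdeg_pos[OF assms(1,2), of x u]
  by (auto simp: lazy_measure_def positive_weight_def less_imp_le)

lemma sum_lazy_measure_1:
  assumes "simple_graph V E" "positive_weight E \<omega>" "{x, y} \<in> E"
  shows "sum (lazy_measure E \<omega> \<alpha> x) V = 1"
  using sum_lazy_measure[OF assms(1), of x \<omega> \<alpha> "\<lambda>_. 1"] simple_graph_edgeD[OF assms(1,3)]
    wdeg_pos[OF assms] by (simp add: wdeg_def)

text \<open>The potential takes the values \<open>3, 2, 1, 0\<close> along a path of three edges with middle edge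
  \<open>{x, y}\<close>; girth six makes every such path a geodesic.\<close>

lemma wasserstein_lazy_measure:
  fixes V :: "'v set" and x y :: 'v
  assumes "simple_graph V E" "girth E \<ge> 6" "positive_weight E \<omega>" "{x, y} \<in> E"
    and "1 / 2 \<le> \<alpha>" "\<alpha> < 1"
  shows "wasserstein V E (lazy_measure E \<omega> \<alpha> x) (lazy_measure E \<omega> \<alpha> y) =
     1 - (1 - \<alpha>) * (2 * (\<omega> {x, y} / wdeg E \<omega> x + \<omega> {x, y} / wdeg E \<omega> y) - 2)"
proof -
  define f :: "'v \<Rightarrow> real" where
    "f u = (if u = x then 2 else if u = y then 1 else if {x, u} \<in> E then 3 else 0)" for u
  let ?\<mu> = "lazy_measure E \<omega> \<alpha> x" and ?\<nu> = "lazy_measure E \<omega> \<alpha> y"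
  have yx: "{y, x} \<in> E" using assms(4) by (simp add: insert_commute)
  note V = simple_graph_edgeD(1,2)[OF assms(1,4)]
  have xy: "x \<noteq> y" using simple_graph_edgeD(3)[OF assms(1,4)] .
  note ne = simple_graph_edgeD(3)[OF assms(1)]
  note tri = no_triangle[OF assms(1,2)]
  have fin: "finite V" using assms(1) by (simp add: simple_graph_def)
  have mx: "wdeg E \<omega> x > 0" and my: "wdeg E \<omega> y > 0"
    using wdeg_pos[OF assms(1,3)] assms(4) yx by blast+
  have far: "{x, w} \<notin> E" if "{y, w} \<in> E" for w
    using tri[of x y w] that assms(4) by (auto simp: insert_commute)

  \<comment> \<open>Only the pair \<open>(y, x)\<close> fails to be tight: there \<open>f\<close> increases.\<close>
  have dist: "real (gdist E u v) = f u - f v"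
    if u: "u = x \<or> {x, u} \<in> E" and v: "v = y \<or> {y, v} \<in> E" and not: "\<not> (u = y \<and> v = x)" for u v
  proof -
    have "{u, x} \<in> E \<longleftrightarrow> {x, u} \<in> E" by (simp add: insert_commute)
    then consider "u = v" | "{u, v} \<in> E" "u = x \<and> v = y \<or> v = x \<and> u \<noteq> y \<or> u = y \<and> v \<noteq> x"
      | "u \<noteq> x" "u \<noteq> y" "v = y" | "u = x" "v \<noteq> x" "v \<noteq> y"
      | "u \<noteq> x" "u \<noteq> y" "v \<noteq> x" "v \<noteq> y"
      using u v not assms(4) by blast
    then show ?thesis
    proof cases
      case 1
      then show ?thesis by (simp add: gdist_self)
    next
      case 2
      then have "gdist E u v = 1" using gdist_adjacent[OF assms(1)] by blast
      moreover from 2(2) have "f u - f v = 1"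
      proof (elim disjE conjE)
        assume "u = x" "v = y"
        then show ?thesis using xy by (simp add: f_def)
      next
        assume "v = x" "u \<noteq> y"
        then show ?thesis using u ne[OF 2(1)] by (simp add: f_def)
      next
        assume "u = y" "v \<noteq> x"
        then show ?thesis using far[of v] ne[OF 2(1)] 2(1) xy by (simp add: f_def)
      qed
      ultimately show ?thesis by simp
    next
      case 3
      then have ux: "{u, x} \<in> E" using u by (auto simp: insert_commute)
      have "gdist E u v = 2"
      proof (rule gdist_eqI)
        show "linked E 2 u v" using ux assms(4) 3 by (auto simp: numeral_2_eq_2)
        fix j assume "j < (2::nat)"
        then consider "j = 0" | "j = 1" by linarith
        then show "\<not> linked E j u v"
          using 3 tri[of u x y] ux assms(4) by cases (auto simp: insert_commute)
      qed
      then show ?thesis using 3 u xy unfolding f_def by auto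
    next
      case 4
      then have yv: "{y, v} \<in> E" using v by auto
      have "gdist E u v = 2"
      proof (rule gdist_eqI)
        show "linked E 2 u v" using yv assms(4) 4 by (auto simp: numeral_2_eq_2)
        fix j assume "j < (2::nat)"
        then consider "j = 0" | "j = 1" by linarith
        then show "\<not> linked E j u v"
          using 4 far[OF yv] by cases (auto simp: insert_commute)
      qed
      then show ?thesis using 4 far[OF yv] unfolding f_def by auto
    next
      case 5
      then have yv: "{y, v} \<in> E" and ux: "{u, x} \<in> E" using u v by (auto simp: insert_commute)
      have xv: "{x, v} \<notin> E" using far[OF yv] .
      have uy: "{u, y} \<notin> E" using tri[of u x y] ux assms(4) by (auto simp: insert_commute)
      have uv: "u \<noteq> v" using ux xv by (auto simp: insert_commute)
      have nuv: "{u, v} \<notin> E"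
        using no_square[OF assms(1,2) ux assms(4) yv] 5 by (auto simp: insert_commute)
      have no_mid: "\<not> ({u, c} \<in> E \<and> {c, v} \<in> E)" for c
      proof
        assume c: "{u, c} \<in> E \<and> {c, v} \<in> E"
        then have "c \<noteq> x" "c \<noteq> y" "c \<noteq> u" "c \<noteq> v" using xv uy uv nuv by (auto simp: ne)
        with no_pentagon[OF assms(1,2) ux assms(4) yv, of c] c 5 xy uv
        show False by (auto simp: insert_commute)
      qed
      have "gdist E u v = 3"
      proof (rule gdist_eqI)
        show "linked E 3 u v" using ux yv assms(4) by (auto simp: numeral_3_eq_3)
        fix j assume "j < (3::nat)"
        then consider "j = 0" | "j = 1" | "j = 2" by linarith
        then show "\<not> linked E j u v"
          using uv nuv no_mid by cases (auto simp: numeral_2_eq_2)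
      qed
      then show ?thesis using 5 ux xv unfolding f_def by (auto simp: insert_commute)
    qed
  qed
  have supp: "u = a \<or> {a, u} \<in> E" if "lazy_measure E \<omega> \<alpha> a u \<noteq> 0" for a u
    using that by (auto simp: lazy_measure_def split: if_splits)

  let ?\<pi> = "\<lambda>u v. if u = y then if v = y then ?\<mu> y else 0
           else ?\<mu> u * (?\<nu> v - (if v = y then ?\<mu> y else 0)) / (1 - ?\<mu> y)"
  \<comment> \<open>Laziness at least one half leaves enough mass of the second measure at \<open>y\<close> to absorb all
    that the first one has there.\<close>
  have "?\<mu> y \<le> 1 / 2"
  proof -
    have "\<omega> {x, y} \<le> wdeg E \<omega> x"
      unfolding wdeg_def using assms(3,4) finite_neighbours[OF assms(1)]
      by (intro member_le_sum[where f = "\<lambda>y. \<omega> {x, y}"])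
        (auto simp: positive_weight_def less_imp_le)
    then have "\<omega> {x, y} / wdeg E \<omega> x \<le> 1" using mx by simp
    then have "(1 - \<alpha>) * (\<omega> {x, y} / wdeg E \<omega> x) \<le> (1 - \<alpha>) * 1"
      using assms by (intro mult_left_mono) auto
    also have "\<dots> \<le> 1 / 2" using assms(5) by simp
    also have "(1 - \<alpha>) * (\<omega> {x, y} / wdeg E \<omega> x) = ?\<mu> y"
      using assms xy by (simp add: lazy_measure_def)
    finally show ?thesis .
  qed
  moreover have "?\<nu> y = \<alpha>" by (simp add: lazy_measure_def)
  ultimately have mass: "?\<mu> y \<le> ?\<nu> y" "?\<mu> y < 1" using assms(5) by linarith+
  have \<alpha>: "0 \<le> \<alpha>" "\<alpha> \<le> 1" using assms(5,6) by auto
  note nonneg = lazy_measure_nonneg[OF assms(1,3) \<alpha>]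
  have coup: "coupling V ?\<mu> ?\<nu> ?\<pi>"
    by (rule coupling_fixing_vertex[OF fin V(2) nonneg nonneg
          sum_lazy_measure_1[OF assms(1,3,4)] sum_lazy_measure_1[OF assms(1,3) yx] mass])
  have "wasserstein V E ?\<mu> ?\<nu> = (\<Sum>u\<in>V. ?\<mu> u * f u) - (\<Sum>v\<in>V. ?\<nu> v * f v)"
  proof (rule wasserstein_eq_potential[OF fin coup])
    fix u v assume "?\<mu> u \<noteq> 0" "?\<nu> v \<noteq> 0"
    then show "f u - f v \<le> real (gdist E u v)"
      using dist[of u v] supp[of x u] supp[of y v] xy
      by (cases "u = y \<and> v = x") (auto simp: f_def)
  next
    fix u v assume uv: "u \<in> V" "v \<in> V" "?\<pi> u v \<noteq> 0"
    then have "\<not> (u = y \<and> v = x)" using xy by auto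
    with coupling_support[OF fin coup uv] show "real (gdist E u v) = f u - f v"
      using supp by (intro dist) auto
  qed
  also have "(\<Sum>u\<in>V. ?\<mu> u * f u) =
    \<alpha> * 2 + (1 - \<alpha>) * (3 * wdeg E \<omega> x - 2 * \<omega> {x, y}) / wdeg E \<omega> x"
  proof -
    have "(\<Sum>z | {x, z} \<in> E. \<omega> {x, z} * f z) =
      (\<Sum>z | {x, z} \<in> E. 3 * \<omega> {x, z} - (if z = y then 2 * \<omega> {x, y} else 0))"
      using ne[of x] xy by (intro sum.cong) (auto simp: f_def)
    also have "\<dots> = 3 * wdeg E \<omega> x - 2 * \<omega> {x, y}"
      using finite_neighbours[OF assms(1)] assms(4)
      by (simp add: sum_subtractf sum.delta wdeg_def flip: sum_distrib_left)
    finally show ?thesis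
      using sum_lazy_measure[OF assms(1) V(1)] by (simp add: f_def)
  qed
  also have "(\<Sum>v\<in>V. ?\<nu> v * f v) = \<alpha> + (1 - \<alpha>) * (2 * \<omega> {x, y}) / wdeg E \<omega> y"
  proof -
    have "(\<Sum>w | {y, w} \<in> E. \<omega> {y, w} * f w) =
      (\<Sum>w | {y, w} \<in> E. if w = x then 2 * \<omega> {x, y} else 0)"
      using ne[of y] xy far by (intro sum.cong) (auto simp: f_def insert_commute)
    also have "\<dots> = 2 * \<omega> {x, y}"
      using finite_neighbours[OF assms(1)] yx by (simp add: sum.delta)
    finally show ?thesis
      using sum_lazy_measure[OF assms(1) V(2)] xy by (simp add: f_def)
  qed
  finally show ?thesis using mx my by (simp add: field_simps)
qed

lemma lly_curvature_edge:
  assumes "simple_graph V E" "girth E \<ge> 6" "positive_weight E \<omega>" "{x, y} \<in> E"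
  shows "lly_curvature V E \<omega> x y = 2 * (\<omega> {x, y} / wdeg E \<omega> x + \<omega> {x, y} / wdeg E \<omega> y) - 2"
    (is "_ = ?k")
proof -
  have "eventually (\<lambda>\<alpha>::real. \<alpha> \<in> {1/2<..<1}) (at_left 1)"
    by (rule eventually_at_left_real) simp
  then have "eventually (\<lambda>\<alpha>. 1 / (1 - \<alpha>) *
     (1 - wasserstein V E (lazy_measure E \<omega> \<alpha> x) (lazy_measure E \<omega> \<alpha> y) / real (gdist E x y)) = ?k)
     (at_left 1)"
  proof eventually_elim
    case (elim \<alpha>)
    then show ?case
      using wasserstein_lazy_measure[OF assms, of \<alpha>] gdist_adjacent[OF assms(1,4)] by simp
  qed
  then have "((\<lambda>\<alpha>. 1 / (1 - \<alpha>) *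
     (1 - wasserstein V E (lazy_measure E \<omega> \<alpha> x) (lazy_measure E \<omega> \<alpha> y) / real (gdist E x y)))
     \<longlongrightarrow> ?k) (at_left 1)" by (rule tendsto_eventually)
  then show ?thesis
    unfolding lly_curvature_def by (intro tendsto_Lim) (simp_all add: trivial_limit_at_left_real)
qed

definition edges_at :: "'v set set \<Rightarrow> 'v \<Rightarrow> 'v set set" where
  "edges_at E x = {e \<in> E. x \<in> e}"

lemma wdeg_eq_sum_edges_at:
  assumes "simple_graph V E"
  shows "wdeg E \<omega> x = sum \<omega> (edges_at E x)"
proof -
  have "edges_at E x = (\<lambda>y. {x, y}) ` {y. {x, y} \<in> E}"
  proof (intro equalityI subsetI)
    fix e assume e: "e \<in> edges_at E x"
    then have "card e = 2" "x \<in> e" "e \<in> E" using assms by (auto simp: edges_at_def simple_graph_def)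
    then obtain y where "e = {x, y}" by (metis card_2_iff insert_commute insertE singletonD)
    with \<open>e \<in> E\<close> show "e \<in> (\<lambda>y. {x, y}) ` {y. {x, y} \<in> E}" by blast
  qed (auto simp: edges_at_def)
  then show ?thesis
    unfolding wdeg_def by (simp add: sum.reindex inj_on_def doubleton_eq_iff)
qed

lemma edge_curvature_formula:
  assumes "simple_graph V E" "girth E \<ge> 6" "positive_weight E \<omega>" "e \<in> E"
  shows "edge_curvature V E \<omega> e = 2 * (\<Sum>x\<in>e. \<omega> e / sum \<omega> (edges_at E x)) - 2"
proof -
  obtain x y where e: "e = {x, y}" "x \<noteq> y"
    using assms by (auto simp: simple_graph_def card_2_iff)
  with assms show ?thesis
    using lly_curvature_edge[of V E \<omega> x y]
    by (simp add: edge_curvature_eq wdeg_eq_sum_edges_at[OF assms(1)])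
qed


section \<open>Dissipation at a vertex\<close>

text \<open>This is the identity behind Chebyshev's sum inequality: up to a factor, the left side is minus
  the covariance of \<open>s\<close> and \<open>g\<close> under the weights \<open>m\<close>, and the right side symmetrises it over pairs.
  For \<open>g\<close> an increasing function of \<open>s\<close> the sign becomes visible.\<close>

lemma sum_covariance_pairs:
  fixes m g s :: "'a \<Rightarrow> real"
  shows "2 * (\<Sum>e\<in>S. s e * m e * ((\<Sum>f\<in>S. m f * g f) - g e * sum m S)) =
    - (\<Sum>e\<in>S. \<Sum>f\<in>S. m e * m f * ((s e - s f) * (g e - g f)))"
proof -
  define T where "T e f = s e * m e * (m f * g f - g e * m f)" for e f
  have "(\<Sum>e\<in>S. s e * m e * ((\<Sum>f\<in>S. m f * g f) - g e * sum m S)) = (\<Sum>e\<in>S. \<Sum>f\<in>S. T e f)"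
    by (simp add: T_def sum_distrib_left flip: sum_subtractf)
  moreover have "(\<Sum>e\<in>S. \<Sum>f\<in>S. T e f) = (\<Sum>e\<in>S. \<Sum>f\<in>S. T f e)"
    by (rule sum.swap)
  ultimately have "2 * (\<Sum>e\<in>S. s e * m e * ((\<Sum>f\<in>S. m f * g f) - g e * sum m S)) =
      (\<Sum>e\<in>S. \<Sum>f\<in>S. T e f + T f e)"
    by (simp add: sum.distrib)
  also have "\<dots> = (\<Sum>e\<in>S. \<Sum>f\<in>S. - (m e * m f * ((s e - s f) * (g e - g f))))"
    by (intro sum.cong refl) (simp add: T_def algebra_simps)
  finally show ?thesis by (simp add: sum_negf)
qed

lemma exp_strongly_monotone:
  fixes a b :: real
  assumes "\<bar>a\<bar> \<le> B" "\<bar>b\<bar> \<le> B"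
  shows "exp (- B) * (a - b)\<^sup>2 \<le> (a - b) * (exp a - exp b)"
proof -
  have *: "exp (- B) * (a - b)\<^sup>2 \<le> (a - b) * (exp a - exp b)" if "b \<le> a" "- B \<le> b" for a b
  proof -
    have "a - b \<le> exp (a - b) - 1" using exp_ge_add_one_self[of "a - b"] by linarith
    then have "exp (- B) * (a - b) \<le> exp b * (exp (a - b) - 1)"
      using that by (intro mult_mono) auto
    also have "\<dots> = exp a - exp b" by (simp add: algebra_simps flip: exp_add)
    finally have "(a - b) * (exp (- B) * (a - b)) \<le> (a - b) * (exp a - exp b)"
      using that by (intro mult_left_mono) auto
    then show ?thesis by (simp add: power2_eq_square algebra_simps)
  qed
  show ?thesis
    using *[of b a] *[of a b] assms by (cases "b \<le> a") (auto simp: power2_commute algebra_simps)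
qed

text \<open>Here \<open>S\<close> plays the role of the edges at a vertex. Over the common denominator
  \<open>sum m S * sum w S\<close> the left side is a multiple of the covariance of \<open>s\<close> and \<open>exp s\<close>. The numerator
  is estimated by the lower bound \<open>exp (- B)\<close> for the slope of \<open>exp\<close> on \<open>[- B, B]\<close>, the
  denominator by its upper bound. The constant depends on the bounds alone, hence can be taken
  uniform in time and over the vertices.\<close>

lemma dissipation_at_vertex:
  fixes m s :: "'a \<Rightarrow> real"
  assumes "finite S" "a > 0" "\<And>e. e \<in> S \<Longrightarrow> a \<le> m e" "sum m S \<le> A"
    and "\<And>e. e \<in> S \<Longrightarrow> \<bar>s e\<bar> \<le> B"
    and w: "\<And>e. w e = m e * exp (s e)"
  shows "(\<Sum>e\<in>S. s e * (m e / sum m S - w e / sum w S)) \<le>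
    - (a\<^sup>2 * exp (- B) / (2 * (A * (A * exp B)))) * (\<Sum>e\<in>S. \<Sum>f\<in>S. (s e - s f)\<^sup>2)"
proof (cases "S = {}")
  case False
  define D where "D = (\<Sum>e\<in>S. \<Sum>f\<in>S. (s e - s f)\<^sup>2)"
  have D: "D \<ge> 0" unfolding D_def by (intro sum_nonneg) auto
  have mpos: "m e > 0" if "e \<in> S" for e using assms(2,3) that by force
  have M: "sum m S > 0" using assms(1) False mpos by (intro sum_pos) auto
  have W: "sum w S > 0" using assms(1) False mpos by (intro sum_pos) (auto simp: w)
  have A: "A > 0" using M assms(4) by linarith
  have "sum w S \<le> (\<Sum>e\<in>S. m e * exp B)"
    unfolding w using assms(5) mpos
    by (intro sum_mono mult_left_mono) (auto simp: abs_le_iff less_imp_le)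
  also have "\<dots> \<le> A * exp B" using assms(4) by (simp flip: sum_distrib_right)
  finally have MW: "sum m S * sum w S \<le> A * (A * exp B)"
    using assms(4) M W A by (intro mult_mono) auto
  have "a\<^sup>2 * exp (- B) * D \<le> (\<Sum>e\<in>S. \<Sum>f\<in>S. m e * m f * ((s e - s f) * (exp (s e) - exp (s f))))"
    unfolding D_def sum_distrib_left
  proof (intro sum_mono)
    fix e f assume ef: "e \<in> S" "f \<in> S"
    have "a * a \<le> m e * m f" using assms(2,3) ef mpos by (intro mult_mono) (auto simp: less_imp_le)
    then have "a\<^sup>2 * (exp (- B) * (s e - s f)\<^sup>2)
       \<le> m e * m f * ((s e - s f) * (exp (s e) - exp (s f)))"
      unfolding power2_eq_square[of a]
      using exp_strongly_monotone[OF assms(5)[OF ef(1)] assms(5)[OF ef(2)]]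
      by (rule mult_mono) (use ef mpos in \<open>auto simp: less_imp_le\<close>)
    then show "a\<^sup>2 * exp (- B) * (s e - s f)\<^sup>2
       \<le> m e * m f * ((s e - s f) * (exp (s e) - exp (s f)))" by simp
  qed
  also have "\<dots> = - 2 * (\<Sum>e\<in>S. s e * m e * (sum w S - exp (s e) * sum m S))"
    using sum_covariance_pairs[of s m "\<lambda>e. exp (s e)" S] by (simp add: w)
  also have "(\<Sum>e\<in>S. s e * m e * (sum w S - exp (s e) * sum m S)) =
      (\<Sum>e\<in>S. (sum m S * sum w S) * (s e * (m e / sum m S - w e / sum w S)))"
  proof (rule sum.cong)
    fix e
    have "s e * m e * (y - exp (s e) * x) = (x * y) * (s e * (m e / x - w e / y))"
      if "x > 0" "y > 0" for x y
      using that by (simp add: w field_simps)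
    from this[OF M W] show "s e * m e * (sum w S - exp (s e) * sum m S) =
      (sum m S * sum w S) * (s e * (m e / sum m S - w e / sum w S))" .
  qed simp
  also have "\<dots> = (sum m S * sum w S) * (\<Sum>e\<in>S. s e * (m e / sum m S - w e / sum w S))"
    by (rule sum_distrib_left[symmetric])
  finally have "(\<Sum>e\<in>S. s e * (m e / sum m S - w e / sum w S)) \<le>
     - (a\<^sup>2 * exp (- B) * D / (2 * (sum m S * sum w S)))"
    using M W by (simp add: field_simps)
  also have "\<dots> \<le> - (a\<^sup>2 * exp (- B) * D / (2 * (A * (A * exp B))))"
    using M W D MW A by (intro le_imp_neg_le divide_left_mono) auto
  finally show ?thesis by (simp add: D_def)
qed simp

section \<open>A Poincare inequality for functions on edges\<close>

definition vertex_energy :: "'v set \<Rightarrow> 'v set set \<Rightarrow> ('v set \<Rightarrow> real) \<Rightarrow> real" where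
  "vertex_energy V E s = (\<Sum>x\<in>V. \<Sum>e\<in>edges_at E x. \<Sum>f\<in>edges_at E x. (s e - s f)\<^sup>2)"

lemma simple_graph_finite_edges:
  assumes "simple_graph V E"
  shows "finite E"
  using assms by (intro finite_subset[of E "Pow V"]) (auto simp: simple_graph_def)

lemma finite_edges_at: "simple_graph V E \<Longrightarrow> finite (edges_at E x)"
  using simple_graph_finite_edges[of V E] by (simp add: edges_at_def)

lemma vertex_energy_nonneg: "vertex_energy V E s \<ge> 0"
  unfolding vertex_energy_def by (intro sum_nonneg) auto

lemma sum_over_incidences:
  assumes "simple_graph V E"
  shows "(\<Sum>e\<in>E. \<Sum>x\<in>e. h e x) = (\<Sum>x\<in>V. \<Sum>e\<in>edges_at E x. h e x)"
proof -
  have "(\<Sum>e\<in>E. \<Sum>x\<in>e. h e x) = (\<Sum>e\<in>E. \<Sum>x | x \<in> V \<and> x \<in> e. h e x)"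
    using assms by (intro sum.cong) (auto simp: simple_graph_def)
  also have "\<dots> = (\<Sum>x\<in>V. \<Sum>e | e \<in> E \<and> x \<in> e. h e x)"
    using assms simple_graph_finite_edges[OF assms]
    by (intro sum.swap_restrict) (auto simp: simple_graph_def)
  finally show ?thesis by (simp add: edges_at_def)
qed

lemma vertex_energy_ge_incident:
  assumes "simple_graph V E" "e \<in> E" "f \<in> E" "x \<in> e" "x \<in> f"
  shows "(s e - s f)\<^sup>2 \<le> vertex_energy V E s"
proof -
  have "(s e - s f)\<^sup>2 \<le> (\<Sum>f\<in>edges_at E x. (s e - s f)\<^sup>2)"
    using assms finite_edges_at[OF assms(1)]
    by (intro member_le_sum[where f = "\<lambda>f. (s e - s f)\<^sup>2"]) (auto simp: edges_at_def)
  also have "\<dots> \<le> (\<Sum>e\<in>edges_at E x. \<Sum>f\<in>edges_at E x. (s e - s f)\<^sup>2)"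
    using assms finite_edges_at[OF assms(1)]
    by (intro member_le_sum[where f = "\<lambda>e. \<Sum>f\<in>edges_at E x. (s e - s f)\<^sup>2"])
      (auto simp: edges_at_def intro: sum_nonneg)
  also have "\<dots> \<le> vertex_energy V E s"
    unfolding vertex_energy_def using assms
    by (intro member_le_sum[where f = "\<lambda>x. \<Sum>e\<in>edges_at E x. \<Sum>f\<in>edges_at E x. (s e - s f)\<^sup>2"])
      (auto simp: simple_graph_def intro!: sum_nonneg)
  finally show ?thesis .
qed

text \<open>Consecutive edges of a walk share a vertex, so the values of \<open>s\<close> at its two ends can be compared
  edge by edge; each step costs a factor through \<open>(a + b)\<^sup>2 \<le> 2 * a\<^sup>2 + 2 * b\<^sup>2\<close>.\<close>

lemma vertex_energy_controls_walk:
  assumes "simple_graph V E" "walk E p" "e \<in> E" "hd p \<in> e" "f \<in> E" "last p \<in> f"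
  shows "\<exists>C\<ge>0. \<forall>s. (s e - s f)\<^sup>2 \<le> C * vertex_energy V E s"
  using assms(2-)
proof (induction p arbitrary: e)
  case Nil
  then show ?case by (simp add: walk_def)
next
  case (Cons x p)
  show ?case
  proof (cases p)
    case Nil
    with Cons.prems vertex_energy_ge_incident[OF assms(1), of e f x]
    show ?thesis by (intro exI[of _ 1]) auto
  next
    case (Cons y q)
    let ?g = "{x, y}"
    have g: "?g \<in> E" and "walk E p"
      using Cons.prems(1) Cons by (auto simp: walk_def)
    with Cons.IH[of ?g] Cons.prems Cons obtain C
      where C: "C \<ge> 0" "\<And>s. (s ?g - s f)\<^sup>2 \<le> C * vertex_energy V E s" by auto
    have "(s e - s f)\<^sup>2 \<le> (2 + 2 * C) * vertex_energy V E s" for s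
    proof -
      have "(s e - s f)\<^sup>2 \<le> 2 * (s e - s ?g)\<^sup>2 + 2 * (s ?g - s f)\<^sup>2"
        using zero_le_power2[of "s e - 2 * s ?g + s f"] by (simp add: power2_eq_square algebra_simps)
      also have "\<dots> \<le> 2 * vertex_energy V E s + 2 * (C * vertex_energy V E s)"
        using C(2)[of s] vertex_energy_ge_incident[OF assms(1), of e ?g x s] Cons.prems g
        by (intro add_mono mult_left_mono) auto
      finally show ?thesis by (simp add: algebra_simps)
    qed
    then show ?thesis using C(1) by (intro exI[of _ "2 + 2 * C"]) auto
  qed
qed

text \<open>For mean zero, \<open>\<Sum>s(e)\<^sup>2\<close> is a multiple of the sum of \<open>(s(e) - s(f))\<^sup>2\<close> over all pairs of edges,
  and connectedness provides a walk between any two of them.\<close>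

lemma edge_poincare:
  assumes "simple_graph V E" "connected_graph V E"
  shows "\<exists>C>0. \<forall>s. sum s E = 0 \<longrightarrow> (\<Sum>e\<in>E. (s e)\<^sup>2) \<le> C * vertex_energy V E s"
proof -
  have fin: "finite E" using simple_graph_finite_edges[OF assms(1)] .
  have "\<exists>C\<ge>0. \<forall>s. (s e - s f)\<^sup>2 \<le> C * vertex_energy V E s" if ef: "e \<in> E" "f \<in> E" for e f
  proof -
    have "e \<noteq> {}" "e \<subseteq> V" "f \<noteq> {}" "f \<subseteq> V" using assms(1) ef by (auto simp: simple_graph_def)
    then obtain x y where xy: "x \<in> e" "y \<in> f" "x \<in> V" "y \<in> V" by blast
    then obtain p where "walk E p" "hd p = x" "last p = y"
      using assms(2) unfolding connected_graph_def by blast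
    with xy vertex_energy_controls_walk[OF assms(1) _ ef(1) _ ef(2)] show ?thesis by blast
  qed
  then obtain C where C: "\<And>e f. e \<in> E \<Longrightarrow> f \<in> E \<Longrightarrow> C e f \<ge> 0"
    "\<And>e f s. e \<in> E \<Longrightarrow> f \<in> E \<Longrightarrow> (s e - s f)\<^sup>2 \<le> C e f * vertex_energy V E s" by metis
  define K where "K = (\<Sum>e\<in>E. \<Sum>f\<in>E. C e f)"
  have K: "K \<ge> 0" unfolding K_def using C(1) by (intro sum_nonneg)
  have "(\<Sum>e\<in>E. (s e)\<^sup>2) \<le> (K + 1) * vertex_energy V E s" if s: "sum s E = 0" for s
  proof (cases "E = {}")
    case False
    let ?n = "real (card E)"
    have "(\<Sum>e\<in>E. \<Sum>f\<in>E. (s e - s f)\<^sup>2) =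
       (\<Sum>e\<in>E. ?n * (s e)\<^sup>2 + (\<Sum>f\<in>E. (s f)\<^sup>2) - 2 * s e * sum s E)"
      by (simp add: power2_diff sum.distrib sum_subtractf sum_distrib_left)
    also have "\<dots> = 2 * ?n * (\<Sum>e\<in>E. (s e)\<^sup>2)"
      by (simp add: s sum.distrib flip: sum_distrib_left)
    finally have eq: "(\<Sum>e\<in>E. \<Sum>f\<in>E. (s e - s f)\<^sup>2) = 2 * ?n * (\<Sum>e\<in>E. (s e)\<^sup>2)" .
    have "?n \<ge> 1" using False fin by (simp add: Suc_le_eq card_gt_0_iff)
    then have "1 * (\<Sum>e\<in>E. (s e)\<^sup>2) \<le> 2 * ?n * (\<Sum>e\<in>E. (s e)\<^sup>2)"
      by (intro mult_right_mono sum_nonneg) auto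
    also have "\<dots> \<le> (\<Sum>e\<in>E. \<Sum>f\<in>E. C e f * vertex_energy V E s)"
      unfolding eq[symmetric] using C(2) by (intro sum_mono)
    also have "\<dots> = K * vertex_energy V E s" by (simp add: K_def sum_distrib_right)
    also have "\<dots> \<le> (K + 1) * vertex_energy V E s"
      using vertex_energy_nonneg[of V E s] by (intro mult_right_mono) auto
    finally show ?thesis by simp
  qed (use K vertex_energy_nonneg[of V E s] in simp)
  then show ?thesis using K by (intro exI[of _ "K + 1"]) auto
qed

section \<open>Convergence of the flow\<close>

text \<open>The velocity of \<open>ln w(e)\<close> under the flow whose prescribed curvature is that of \<open>m\<close>: the
  difference of the curvatures of \<open>m\<close> and \<open>w\<close> at \<open>e\<close>.\<close>

definition log_drift :: "'v set set \<Rightarrow> ('v set \<Rightarrow> real) \<Rightarrow> ('v set \<Rightarrow> real) \<Rightarrow> 'v set \<Rightarrow> real" where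
  "log_drift E m w e = 2 * (\<Sum>x\<in>e. m e / sum m (edges_at E x) - w e / sum w (edges_at E x))"

lemma sum_edges_at_pos:
  assumes "simple_graph V E" "positive_weight E w" "edges_at E x \<noteq> {}"
  shows "sum w (edges_at E x) > 0"
  using assms finite_edges_at[OF assms(1)]
  by (intro sum_pos) (auto simp: positive_weight_def edges_at_def)

text \<open>Summed by vertices, the quotients at a vertex add up to \<open>1\<close> for \<open>m\<close> as well as for \<open>w\<close>, and
  cancel. This is the conservation law of the flow.\<close>

lemma sum_log_drift:
  assumes "simple_graph V E" "positive_weight E m" "positive_weight E w"
  shows "(\<Sum>e\<in>E. log_drift E m w e) = 0"
proof -
  have "(\<Sum>e\<in>E. log_drift E m w e) =
    2 * (\<Sum>x\<in>V. \<Sum>e\<in>edges_at E x. m e / sum m (edges_at E x) - w e / sum w (edges_at E x))"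
    unfolding log_drift_def sum_over_incidences[OF assms(1), symmetric] by (simp add: sum_distrib_left)
  moreover have "(\<Sum>e\<in>edges_at E x. m e / sum m (edges_at E x) - w e / sum w (edges_at E x)) = 0" for x
    using sum_edges_at_pos[OF assms(1,2), of x] sum_edges_at_pos[OF assms(1,3), of x]
    by (cases "edges_at E x = {}") (auto simp: sum_subtractf simp flip: sum_divide_distrib)
  ultimately show ?thesis by simp
qed

lemma log_drift_dissipation:
  assumes "simple_graph V E" "positive_weight E m"
  shows "\<exists>c>0. \<forall>s. (\<forall>e\<in>E. \<bar>s e\<bar> \<le> B) \<longrightarrow>
    (\<Sum>e\<in>E. s e * log_drift E m (\<lambda>e. m e * exp (s e)) e) \<le> - c * vertex_energy V E s"
proof -
  have fin: "finite E" using simple_graph_finite_edges[OF assms(1)] .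
  \<comment> \<open>The additional \<open>1\<close> in both bounds covers a graph with a single vertex, which has no edges.\<close>
  define a where "a = Min (insert 1 (m ` E))"
  define A where "A = sum m E + 1"
  have a: "a > 0" "\<And>e. e \<in> E \<Longrightarrow> a \<le> m e"
    unfolding a_def using fin assms(2) by (auto simp: positive_weight_def)
  have mE: "sum m E \<ge> 0"
    using assms(2) by (intro sum_nonneg) (auto simp: positive_weight_def less_imp_le)
  have A: "A > 0" using mE by (simp add: A_def)
  have mA: "sum m (edges_at E x) \<le> A" for x
  proof -
    have "sum m (edges_at E x) \<le> sum m E"
      using fin assms(2) by (intro sum_mono2) (auto simp: edges_at_def positive_weight_def less_imp_le)
    then show ?thesis by (simp add: A_def)
  qed
  define c where "c = a\<^sup>2 * exp (- B) / (2 * (A * (A * exp B)))"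
  have c: "c > 0" unfolding c_def using a(1) A by simp
  have "(\<Sum>e\<in>E. s e * log_drift E m (\<lambda>e. m e * exp (s e)) e) \<le> - (2 * c) * vertex_energy V E s"
    if s: "\<forall>e\<in>E. \<bar>s e\<bar> \<le> B" for s
  proof -
    define w where "w = (\<lambda>e. m e * exp (s e))"
    let ?F = "\<lambda>x. \<Sum>e\<in>edges_at E x. s e * (m e / sum m (edges_at E x) - w e / sum w (edges_at E x))"
    have "(\<Sum>e\<in>E. s e * log_drift E m w e) = (\<Sum>e\<in>E. \<Sum>x\<in>e.
        2 * (s e * (m e / sum m (edges_at E x) - w e / sum w (edges_at E x))))"
      unfolding log_drift_def by (simp add: sum_distrib_left algebra_simps)
    also have "\<dots> = 2 * (\<Sum>x\<in>V. ?F x)"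
      unfolding sum_over_incidences[OF assms(1)] by (simp add: sum_distrib_left)
    also have "(\<Sum>x\<in>V. ?F x) \<le>
        (\<Sum>x\<in>V. - c * (\<Sum>e\<in>edges_at E x. \<Sum>f\<in>edges_at E x. (s e - s f)\<^sup>2))"
      unfolding c_def using s a mA finite_edges_at[OF assms(1)]
      by (intro sum_mono dissipation_at_vertex) (auto simp: edges_at_def w_def)
    also have "\<dots> = - c * vertex_energy V E s"
      by (simp add: vertex_energy_def sum_distrib_left)
    finally show ?thesis by (simp add: w_def)
  qed
  then show ?thesis using c by (intro exI[of _ "2 * c"]) auto
qed

text \<open>Gronwall's argument: \<open>L t * exp (r * t)\<close> has a nonpositive derivative.\<close>

lemma exp_decay_of_differential_inequality:
  fixes L :: "real \<Rightarrow> real"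
  assumes deriv: "\<And>t. t \<ge> 0 \<Longrightarrow> (L has_real_derivative L' t) (at t within {0..})"
    and le: "\<And>t. t \<ge> 0 \<Longrightarrow> L' t \<le> - r * L t" and "t \<ge> 0"
  shows "L t \<le> L 0 * exp (- r * t)"
proof -
  let ?G = "\<lambda>t. L t * exp (r * t)"
  have d: "(?G has_real_derivative (L' t + r * L t) * exp (r * t)) (at t within {0..})"
    if "t \<ge> 0" for t
    by (rule derivative_eq_intros deriv[OF that] refl | simp add: algebra_simps)+
  have "?G t \<le> ?G 0"
  proof (rule DERIV_nonpos_imp_decreasing_open[OF \<open>t \<ge> 0\<close>])
    fix u assume u: "0 < u" "u < t"
    have "at u within {0..} = at u"
      using u by (intro at_within_interior) (simp add: interior_real_atLeast)
    moreover have "(L' u + r * L u) * exp (r * u) \<le> 0"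
      using le[of u] u by (intro mult_nonpos_nonneg) auto
    ultimately show "\<exists>y. (?G has_real_derivative y) (at u) \<and> y \<le> 0"
      using d[of u] u by auto
  next
    have "continuous_on {0..} ?G"
      unfolding continuous_on_eq_continuous_within using d by (auto intro: DERIV_continuous)
    then show "continuous_on {0..t} ?G" by (rule continuous_on_subset) auto
  qed
  then have "?G t * exp (- r * t) \<le> L 0 * exp (- r * t)" by simp
  then show ?thesis by (simp add: mult.assoc flip: exp_add)
qed

text \<open>In the curvature formula a common factor of the weights cancels.\<close>

lemma weight_of_curvature_scale:
  assumes "simple_graph V E" "girth E \<ge> 6" "weight_of_curvature V E \<kappa> w" "c > 0"
  shows "weight_of_curvature V E \<kappa> (\<lambda>e. c * w e)"
proof -
  have w: "positive_weight E w" and cw: "positive_weight E (\<lambda>e. c * w e)"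
    using assms by (auto simp: weight_of_curvature_def positive_weight_def)
  have "edge_curvature V E (\<lambda>e. c * w e) e = edge_curvature V E w e" if "e \<in> E" for e
    using edge_curvature_formula[OF assms(1,2) w that] edge_curvature_formula[OF assms(1,2) cw that]
      assms(4) by (simp flip: sum_distrib_left)
  then show ?thesis using assms(3) cw by (simp add: weight_of_curvature_def)
qed

lemma abs_exp_minus_one_le:
  fixes x :: real
  assumes "\<bar>x\<bar> \<le> B"
  shows "\<bar>exp x - 1\<bar> \<le> exp B * \<bar>x\<bar>"
proof (cases "x \<ge> 0")
  case True
  have "exp x - 1 = exp x * (1 - exp (- x))" by (simp add: algebra_simps flip: exp_add)
  also have "\<dots> \<le> exp B * x"
    using exp_ge_add_one_self[of "- x"] assms True by (intro mult_mono) auto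
  finally show ?thesis using True by simp
next
  case False
  have "1 - exp x \<le> 1 * - x" using exp_ge_add_one_self[of x] by linarith
  also have "\<dots> \<le> exp B * - x" using False assms by (intro mult_right_mono) auto
  finally show ?thesis using False by simp
qed

text \<open>The dissipation estimate is used twice, since its constant depends on a bound for \<open>s\<close>. With
  the bound \<open>sqrt (L t)\<close> at a single time it shows only that \<open>L' t \<le> 0\<close>; but then \<open>sqrt (L 0)\<close> is a
  bound for all times, and with it the constant becomes uniform.\<close>

lemma log_ratio_decay:
  fixes s :: "real \<Rightarrow> 'v set \<Rightarrow> real"
  assumes "simple_graph V E" "connected_graph V E" "positive_weight E \<eta>"
    and sderiv: "\<And>t e. t \<ge> 0 \<Longrightarrow> e \<in> E \<Longrightarrow> ((\<lambda>t. s t e) has_real_derivative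
      log_drift E \<eta> (\<lambda>e. \<eta> e * exp (s t e)) e) (at t within {0..})"
    and s0: "sum (s 0) E = 0"
  shows "\<exists>B\<ge>0. \<exists>r>0. \<forall>t\<ge>0. \<forall>e\<in>E. \<bar>s t e\<bar> \<le> B * exp (- r * t)"
proof -
  have fin: "finite E" using simple_graph_finite_edges[OF assms(1)] .
  define w where "w t e = \<eta> e * exp (s t e)" for t e
  have wpos: "positive_weight E (w t)" for t
    using assms(3) by (simp add: w_def positive_weight_def)
  have sderiv': "((\<lambda>t. s t e) has_real_derivative log_drift E \<eta> (w t) e) (at t within {0..})"
    if "t \<ge> 0" "e \<in> E" for t e
    using sderiv[OF that] by (simp add: w_def[abs_def])

  have sum_s: "sum (s t) E = 0" if "t \<ge> 0" for t
  proof -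
    have "((\<lambda>t. \<Sum>e\<in>E. s t e) has_real_derivative 0) (at t within {0..})" if "t \<in> {0..}" for t
    proof -
      have "((\<lambda>t. \<Sum>e\<in>E. s t e) has_real_derivative (\<Sum>e\<in>E. log_drift E \<eta> (w t) e)) (at t within {0..})"
        using that by (intro DERIV_sum sderiv') auto
      then show ?thesis using sum_log_drift[OF assms(1,3) wpos] by simp
    qed
    then obtain k where "\<And>t. t \<in> {0..} \<Longrightarrow> sum (s t) E = k"
      using has_field_derivative_zero_constant[of "{0..}" "\<lambda>t. sum (s t) E"] by auto
    from this[of 0] this[of t] s0 that show ?thesis by simp
  qed

  define L where "L t = (\<Sum>e\<in>E. (s t e)\<^sup>2)" for t
  define L' where "L' t = 2 * (\<Sum>e\<in>E. s t e * log_drift E \<eta> (w t) e)" for t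
  have L: "(L has_real_derivative L' t) (at t within {0..})" if "t \<ge> 0" for t
    unfolding L_def L'_def sum_distrib_left
    using that by (auto intro!: derivative_eq_intros sderiv' simp: algebra_simps)
  have dissipation: "\<exists>k>0. \<forall>t\<ge>0. (\<forall>e\<in>E. \<bar>s t e\<bar> \<le> B) \<longrightarrow> L' t \<le> - k * vertex_energy V E (s t)" for B
  proof -
    obtain k where k: "k > 0" and diss: "\<And>u. \<forall>e\<in>E. \<bar>u e\<bar> \<le> B \<Longrightarrow>
      (\<Sum>e\<in>E. u e * log_drift E \<eta> (\<lambda>e. \<eta> e * exp (u e)) e) \<le> - k * vertex_energy V E u"
      using log_drift_dissipation[OF assms(1,3)] by blast
    have "L' t \<le> - (2 * k) * vertex_energy V E (s t)" if "\<forall>e\<in>E. \<bar>s t e\<bar> \<le> B" for t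
      using diss[OF that] by (simp add: L'_def w_def[abs_def])
    with k show ?thesis by (intro exI[of _ "2 * k"]) auto
  qed
  have s_le: "\<bar>s t e\<bar> \<le> sqrt (L t)" if "e \<in> E" for t e
  proof -
    have "(s t e)\<^sup>2 \<le> L t"
      unfolding L_def using that fin by (intro member_le_sum[where f = "\<lambda>e. (s t e)\<^sup>2"]) auto
    then show ?thesis using real_le_rsqrt by (metis power2_abs)
  qed

  have "L' t \<le> - 0 * L t" if t: "t \<ge> 0" for t
  proof -
    obtain k where "k > 0" "L' t \<le> - k * vertex_energy V E (s t)"
      using dissipation[of "sqrt (L t)"] s_le t by blast
    moreover have "k * vertex_energy V E (s t) \<ge> 0"
      using \<open>k > 0\<close> vertex_energy_nonneg[of V E "s t"] by simp
    ultimately show ?thesis by simp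
  qed
  from exp_decay_of_differential_inequality[OF L this]
  have L_le: "L t \<le> L 0" if "t \<ge> 0" for t using that by simp
  define B where "B = sqrt (L 0)"
  have sB: "\<bar>s t e\<bar> \<le> B" if "t \<ge> 0" "e \<in> E" for t e
    using s_le[OF that(2), of t] real_sqrt_le_mono[OF L_le[OF that(1)]]
    unfolding B_def by linarith

  obtain k where k: "k > 0" "\<And>t. t \<ge> 0 \<Longrightarrow> L' t \<le> - k * vertex_energy V E (s t)"
    using dissipation[of B] sB by blast
  obtain P where P: "P > 0" "\<And>u. sum u E = 0 \<Longrightarrow> (\<Sum>e\<in>E. (u e)\<^sup>2) \<le> P * vertex_energy V E u"
    using edge_poincare[OF assms(1,2)] by blast
  define r where "r = k / P"
  have r: "r > 0" using k P by (simp add: r_def)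
  have "L' t \<le> - r * L t" if "t \<ge> 0" for t
  proof -
    have "L t \<le> P * vertex_energy V E (s t)" using P(2) sum_s[OF that] by (simp add: L_def)
    then have "r * L t \<le> r * (P * vertex_energy V E (s t))" using r by (intro mult_left_mono) auto
    also have "\<dots> = k * vertex_energy V E (s t)" using P(1) by (simp add: r_def)
    finally show ?thesis using k(2)[OF that] by simp
  qed
  from exp_decay_of_differential_inequality[OF L this]
  have decay: "L t \<le> L 0 * exp (- r * t)" if "t \<ge> 0" for t using that by simp
  have "\<bar>s t e\<bar> \<le> B * exp (- (r / 2) * t)" if t: "t \<ge> 0" and e: "e \<in> E" for t e
  proof -
    have "exp (- r * t) = (exp (- (r / 2) * t))\<^sup>2" by (simp flip: exp_double)
    with decay[OF t] have "sqrt (L t) \<le> sqrt (L 0 * (exp (- (r / 2) * t))\<^sup>2)" by simp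
    then have "sqrt (L t) \<le> B * exp (- (r / 2) * t)" by (simp add: real_sqrt_mult B_def)
    with s_le[OF e, of t] show ?thesis by linarith
  qed
  moreover have "B \<ge> 0" by (auto simp: B_def L_def intro: sum_nonneg)
  ultimately show ?thesis using r by (intro exI[of _ B] conjI exI[of _ "r / 2"]) auto
qed

theorem theorem1p1:
  fixes V :: "'v set" and E :: "'v set set"
    and \<kappa> :: "'v set \<Rightarrow> real"
    and \<omega>\<^sub>0 :: "'v set \<Rightarrow> real"
    and \<omega> :: "real \<Rightarrow> 'v set \<Rightarrow> real"
  assumes "simple_graph V E"
    and "connected_graph V E"
    and "girth E \<ge> 6"
    and "positive_weight E \<omega>\<^sub>0"
    and "ricci_flow_solution V E \<kappa> \<omega>\<^sub>0 \<omega>"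
  shows "(\<exists>\<eta>. weight_of_curvature V E \<kappa> \<eta> \<and> converges_exponentially E \<omega> \<eta>)
         \<longleftrightarrow> attainable V E \<kappa>"
proof
  assume "attainable V E \<kappa>"
  then obtain m where m: "weight_of_curvature V E \<kappa> m" by (auto simp: attainable_def)
  have fin: "finite E" using simple_graph_finite_edges[OF assms(1)] .
  have mpos: "\<And>e. e \<in> E \<Longrightarrow> m e > 0"
    using m by (auto simp: weight_of_curvature_def positive_weight_def)
  have \<omega>0: "\<And>e. e \<in> E \<Longrightarrow> \<omega> 0 e = \<omega>\<^sub>0 e" and \<omega>0pos: "\<And>e. e \<in> E \<Longrightarrow> \<omega>\<^sub>0 e > 0"
    and \<omega>pw: "\<And>t. t \<ge> 0 \<Longrightarrow> positive_weight E (\<omega> t)"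
    and \<omega>pos: "\<And>t e. t \<ge> 0 \<Longrightarrow> e \<in> E \<Longrightarrow> \<omega> t e > 0"
    and \<omega>deriv: "\<And>t e. t \<ge> 0 \<Longrightarrow> e \<in> E \<Longrightarrow> ((\<lambda>s. \<omega> s e) has_real_derivative
                 - (edge_curvature V E (\<omega> t) e - \<kappa> e) * \<omega> t e) (at t within {0..})"
    using assms(4,5) by (auto simp: ricci_flow_solution_def positive_weight_def)
  \<comment> \<open>Among the multiples of \<open>m\<close> the conservation law singles out the limit: the sum of the
    logarithmic ratios to it has to be zero at the start. So \<open>c\<close> is the geometric mean of the
    initial ratios.\<close>
  define c where "c = exp ((\<Sum>e\<in>E. ln (\<omega>\<^sub>0 e / m e)) / real (card E))"
  define \<eta> where "\<eta> e = c * m e" for e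
  have \<eta>: "weight_of_curvature V E \<kappa> \<eta>"
    using weight_of_curvature_scale[OF assms(1,3) m, of c] by (simp add: \<eta>_def[abs_def] c_def)
  then have \<eta>pw: "positive_weight E \<eta>" by (simp add: weight_of_curvature_def)
  then have \<eta>pos: "\<And>e. e \<in> E \<Longrightarrow> \<eta> e > 0" by (simp add: positive_weight_def)

  define s where "s t e = ln (\<omega> t e / \<eta> e)" for t e
  have \<omega>s: "\<omega> t e = \<eta> e * exp (s t e)" if "t \<ge> 0" "e \<in> E" for t e
    using \<omega>pos[OF that] \<eta>pos[OF that(2)] by (simp add: s_def)
  have drift_cong: "log_drift E \<eta> (\<omega> t) e = log_drift E \<eta> (\<lambda>e. \<eta> e * exp (s t e)) e"
    if "t \<ge> 0" "e \<in> E" for t e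
  proof -
    have "sum (\<omega> t) (edges_at E x) = (\<Sum>e\<in>edges_at E x. \<eta> e * exp (s t e))" for x
      using \<omega>s that by (intro sum.cong) (auto simp: edges_at_def)
    then show ?thesis using that by (simp add: log_drift_def \<omega>s)
  qed
  have sderiv: "((\<lambda>t. s t e) has_real_derivative log_drift E \<eta> (\<omega> t) e) (at t within {0..})"
    if t: "t \<ge> 0" and e: "e \<in> E" for t e
  proof -
    have "log_drift E \<eta> (\<omega> t) e = - (edge_curvature V E (\<omega> t) e - \<kappa> e)"
      using edge_curvature_formula[OF assms(1,3) \<omega>pw[OF t] e]
        edge_curvature_formula[OF assms(1,3) \<eta>pw e] \<eta> e
      by (simp add: log_drift_def weight_of_curvature_def sum_subtractf)
    then show ?thesis
      unfolding s_def using \<omega>pos[OF t e] \<eta>pos[OF e]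
      by (auto intro!: derivative_eq_intros \<omega>deriv[OF t e])
  qed

  have s0: "(\<Sum>e\<in>E. s 0 e) = 0"
  proof (cases "E = {}")
    case False
    have "(\<Sum>e\<in>E. s 0 e) = (\<Sum>e\<in>E. ln (\<omega>\<^sub>0 e / m e) - ln c)"
    proof (intro sum.cong refl)
      fix e assume "e \<in> E"
      then have "\<omega>\<^sub>0 e > 0" "m e > 0" "c > 0" using \<omega>0pos mpos by (auto simp: c_def)
      then show "s 0 e = ln (\<omega>\<^sub>0 e / m e) - ln c"
        using \<omega>0[OF \<open>e \<in> E\<close>] by (simp add: s_def \<eta>_def ln_div ln_mult)
    qed
    also have "\<dots> = 0" using False fin by (simp add: sum_subtractf c_def)
    finally show ?thesis .
  qed simp
  obtain B r where B: "B \<ge> 0" and r: "r > 0"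
    and decay: "\<And>t e. t \<ge> 0 \<Longrightarrow> e \<in> E \<Longrightarrow> \<bar>s t e\<bar> \<le> B * exp (- r * t)"
    using log_ratio_decay[OF assms(1,2) \<eta>pw, of s] sderiv s0 by (auto simp: drift_cong)
  have sB: "\<bar>s t e\<bar> \<le> B" if "t \<ge> 0" "e \<in> E" for t e
  proof -
    have "B * exp (- r * t) \<le> B * 1" using B r that by (intro mult_left_mono) auto
    with decay[OF that] show ?thesis by linarith
  qed
  have conv: "L2_set (\<lambda>e. \<omega> t e - \<eta> e) E \<le> (sum \<eta> E * exp B * B + 1) * exp (- r * t)"
    if t: "t \<ge> 0" for t
  proof -
    have "L2_set (\<lambda>e. \<omega> t e - \<eta> e) E \<le> (\<Sum>e\<in>E. \<bar>\<omega> t e - \<eta> e\<bar>)" by (rule L2_set_le_sum_abs)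
    also have "\<dots> \<le> (\<Sum>e\<in>E. \<eta> e * (exp B * (B * exp (- r * t))))"
    proof (rule sum_mono)
      fix e assume e: "e \<in> E"
      have "\<bar>\<omega> t e - \<eta> e\<bar> = \<eta> e * \<bar>exp (s t e) - 1\<bar>"
        using \<omega>s[OF t e] \<eta>pos[OF e] abs_mult[of "\<eta> e" "exp (s t e) - 1"]
        by (simp add: right_diff_distrib)
      also have "\<dots> \<le> \<eta> e * (exp B * (B * exp (- r * t)))"
      proof (rule mult_left_mono)
        have "\<bar>exp (s t e) - 1\<bar> \<le> exp B * \<bar>s t e\<bar>" by (rule abs_exp_minus_one_le[OF sB[OF t e]])
        also have "\<dots> \<le> exp B * (B * exp (- r * t))"
          using decay[OF t e] by (intro mult_left_mono) auto
        finally show "\<bar>exp (s t e) - 1\<bar> \<le> exp B * (B * exp (- r * t))" .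
      qed (use \<eta>pos[OF e] in simp)
      finally show "\<bar>\<omega> t e - \<eta> e\<bar> \<le> \<eta> e * (exp B * (B * exp (- r * t)))" .
    qed
    also have "\<dots> = sum \<eta> E * exp B * B * exp (- r * t)"
      by (simp add: mult.assoc flip: sum_distrib_right)
    also have "\<dots> \<le> (sum \<eta> E * exp B * B + 1) * exp (- r * t)" by (intro mult_right_mono) auto
    finally show ?thesis .
  qed
  have "sum \<eta> E * exp B * B + 1 > 0"
    using \<eta>pos B by (intro add_nonneg_pos mult_nonneg_nonneg sum_nonneg) (auto simp: less_imp_le)
  then have "converges_exponentially E \<omega> \<eta>"
    unfolding converges_exponentially_def using conv r
    by (intro exI[of _ "sum \<eta> E * exp B * B + 1"] conjI exI[of _ r]) auto
  with \<eta> show "\<exists>\<eta>. weight_of_curvature V E \<kappa> \<eta> \<and> converges_exponentially E \<omega> \<eta>" by blast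
qed (auto simp: attainable_def)

end
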